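(* Let $f$ be a smooth, nowhere zero function of $t$ on an open interval. For a smooth function $w=w(z)$ of one variable put, for $y\neq0$, $$u=\frac{y^2}{6f^2}\Big[w(z)+\frac23f'^2-\Big(\frac{2x}{y^2}f'+f''\Big)f\Big],\qquad z=\frac{fx}{y^2}-\frac{f'}{6}.$$ Then $u$ is invariant under both $\mathbf v_0$ and $\mathbf z_f$, and $u$ solves the ZK equation $u_{xt}-(uu_x)_x-u_{yy}=0$ if and only if $w$ satisfies the ordinary differential equation $$12w-12zw'+w'^2+(w+24z^2)w''=0.$$ In particular, for $w=0$, $u=\frac{y^2}{6f^2}\big[\frac23f'^2-\big(\frac{2x}{y^2}f'+f''\big)f\big]$ is a solution of the ZK equation.
   Context: Vector fields on $(t,x,y,u)$-space: $\mathbf v_0=2x\partial_x+y\partial_y+2u\partial_u$, $\mathbf z_f=f\partial_t+\tfrac16(2xf'+y^2f'')\partial_x+\tfrac{2y}{3}f'\partial_y+\tfrac16(-4uf'-2xf''-y^2f''')\partial_u$. Primes on $f$ denote $d/dt$, primes on $w$ denote $d/dz$. A function $u(t,x,y)$ is invariant under a vector field if the field is tangent to its graph. *)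

theory Defs
  imports "HOL-Analysis.Analysis"
begin

text \<open>All sets \<open>U\<close> below are meant to be open; derivatives are taken in the full neighbourhood
  of each point of \<open>U\<close>.\<close>

primrec Ck_on :: "nat \<Rightarrow> 'a::euclidean_space set \<Rightarrow> ('a \<Rightarrow> real) \<Rightarrow> bool" where
  "Ck_on 0 U g \<longleftrightarrow> continuous_on U g"
| "Ck_on (Suc k) U g \<longleftrightarrow>
     (\<forall>p\<in>U. g differentiable (at p)) \<and>
     (\<forall>b\<in>Basis. Ck_on k U (\<lambda>p. frechet_derivative g (at p) b))"

definition smooth_on :: "'a::euclidean_space set \<Rightarrow> ('a \<Rightarrow> real) \<Rightarrow> bool" where
  "smooth_on U g \<longleftrightarrow> (\<forall>k. Ck_on k U g)"

text \<open>A point of the base space is \<open>(t, x, y)\<close>, a point of the total space is \<open>(t, x, y, u)\<close>; a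
  vector field on the total space is given by its components along
  \<open>\<partial>\<^sub>t, \<partial>\<^sub>x, \<partial>\<^sub>y, \<partial>\<^sub>u\<close>.\<close>

type_synonym base = "real \<times> real \<times> real"
type_synonym total = "real \<times> real \<times> real \<times> real"

definition D_t :: "(base \<Rightarrow> real) \<Rightarrow> base \<Rightarrow> real" where
  "D_t u = (\<lambda>(t, x, y). deriv (\<lambda>s. u (s, x, y)) t)"

definition D_x :: "(base \<Rightarrow> real) \<Rightarrow> base \<Rightarrow> real" where
  "D_x u = (\<lambda>(t, x, y). deriv (\<lambda>s. u (t, s, y)) x)"

definition D_y :: "(base \<Rightarrow> real) \<Rightarrow> base \<Rightarrow> real" where
  "D_y u = (\<lambda>(t, x, y). deriv (\<lambda>s. u (t, x, s)) y)"

text \<open>Classical solutions of \<open>u\<^sub>x\<^sub>t - (u u\<^sub>x)\<^sub>x - u\<^sub>y\<^sub>y = 0\<close>.\<close>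

definition solves_ZK :: "base set \<Rightarrow> (base \<Rightarrow> real) \<Rightarrow> bool" where
  "solves_ZK U u \<longleftrightarrow> Ck_on 2 U u \<and>
     (\<forall>p\<in>U. D_t (D_x u) p - D_x (\<lambda>q. u q * D_x u q) p - D_y (D_y u) p = 0)"

definition graph_map :: "(base \<Rightarrow> real) \<Rightarrow> base \<Rightarrow> total" where
  "graph_map u = (\<lambda>(t, x, y). (t, x, y, u (t, x, y)))"

text \<open>The tangent space of the graph of \<open>u\<close> at \<open>graph_map u p\<close> is the range of the derivative
  of the parametrisation \<open>graph_map u\<close> at \<open>p\<close>.\<close>

definition invariant_under :: "(total \<Rightarrow> total) \<Rightarrow> base set \<Rightarrow> (base \<Rightarrow> real) \<Rightarrow> bool" where
  "invariant_under V U u \<longleftrightarrow>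
     (\<forall>p\<in>U. \<exists>G'. (graph_map u has_derivative G') (at p) \<and> V (graph_map u p) \<in> range G')"

definition v0 :: "total \<Rightarrow> total" where
  "v0 = (\<lambda>(t, x, y, u). (0, 2 * x, y, 2 * u))"

definition z_field :: "(real \<Rightarrow> real) \<Rightarrow> total \<Rightarrow> total" where
  "z_field f = (\<lambda>(t, x, y, u).
     (f t,
      1/6 * (2 * x * deriv f t + y^2 * (deriv ^^ 2) f t),
      2 * y / 3 * deriv f t,
      1/6 * (- 4 * u * deriv f t - 2 * x * (deriv ^^ 2) f t - y^2 * (deriv ^^ 3) f t)))"

definition z_var :: "(real \<Rightarrow> real) \<Rightarrow> base \<Rightarrow> real" where
  "z_var f = (\<lambda>(t, x, y). f t * x / y^2 - deriv f t / 6)"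

definition u_of :: "(real \<Rightarrow> real) \<Rightarrow> (real \<Rightarrow> real) \<Rightarrow> base \<Rightarrow> real" where
  "u_of f w = (\<lambda>(t, x, y). y^2 / (6 * (f t)^2) *
     (w (z_var f (t, x, y)) + 2/3 * (deriv f t)^2
        - (2 * x / y^2 * deriv f t + (deriv ^^ 2) f t) * f t))"

text \<open>The domain of \<open>u_of f w\<close> for \<open>f\<close> defined on \<open>I\<close> and \<open>w\<close> defined on \<open>J\<close>.\<close>

definition u_dom :: "(real \<Rightarrow> real) \<Rightarrow> real set \<Rightarrow> real set \<Rightarrow> base set" where
  "u_dom f I J = {(t, x, y). t \<in> I \<and> y \<noteq> 0 \<and> z_var f (t, x, y) \<in> J}"

definition solves_reduced_ODE :: "real set \<Rightarrow> (real \<Rightarrow> real) \<Rightarrow> bool" where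
  "solves_reduced_ODE J w \<longleftrightarrow>
     (\<forall>z\<in>J. 12 * w z - 12 * z * deriv w z + (deriv w z)^2
              + (w z + 24 * z^2) * (deriv ^^ 2) w z = 0)"

end

theory Submission
  imports Defs
begin

text \<open>
  With \<open>x = y\<^sup>2 (z + f'/6) / f\<close> substituted, all occurrences of \<open>f'\<close> and \<open>f''\<close> cancel in the left-hand
  side of the ZK equation, which becomes \<open>- 1/(36 f\<^sup>2)\<close> times the left-hand side of the reduced
  equation at \<open>z\<close>. Every \<open>z\<close> in the domain of \<open>w\<close> is attained on \<open>y = 1\<close>, so the two equations are
  equivalent. Invariance is a first-order identity between the partial derivatives of \<open>u\<close>, since
  tangency of \<open>V = (a, b, c, d)\<close> to the graph means \<open>d = a u\<^sub>t + b u\<^sub>x + c u\<^sub>y\<close>.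
\<close>

subsection \<open>Closure properties of \<open>C\<^sup>k\<close> functions\<close>

lemma Ck_on_Suc_has_derivative:
  fixes g :: "'a::euclidean_space \<Rightarrow> real"
  assumes "Ck_on (Suc k) U g" "p \<in> U"
  shows "(g has_derivative frechet_derivative g (at p)) (at p)"
  using assms by (simp add: frechet_derivative_works)

text \<open>Both sides are choices from the set of derivatives at \<open>p\<close>. Near
  \<open>p\<close> the functions agree, so the two sets coincide and the choices are equal even
  where neither function is differentiable.\<close>

lemma frechet_derivative_cong_open:
  fixes g h :: "'a::euclidean_space \<Rightarrow> real"
  assumes "open U" "p \<in> U" "\<And>q. q \<in> U \<Longrightarrow> g q = h q"
  shows "frechet_derivative g (at p) = frechet_derivative h (at p)"
proof -
  have "(g has_derivative D) (at p) \<longleftrightarrow> (h has_derivative D) (at p)" for D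
    using has_derivative_transform_within_open[OF _ assms(1,2), of g D UNIV h]
      has_derivative_transform_within_open[OF _ assms(1,2), of h D UNIV g] assms(3)
    by auto
  then show ?thesis
    by (simp add: frechet_derivative_def)
qed

text \<open>The induction generalises over both functions, because its step passes to their partial
  derivatives, which agree on \<open>U\<close> as \<open>U\<close> is open.\<close>

lemma Ck_on_cong:
  fixes g h :: "'a::euclidean_space \<Rightarrow> real"
  assumes "open U" "\<And>p. p \<in> U \<Longrightarrow> g p = h p" "Ck_on k U g"
  shows "Ck_on k U h"
  using assms(2,3)
proof (induction k arbitrary: g h)
  case 0
  then show ?case
    using continuous_on_cong[of U U g h] by simp
next
  case (Suc k)
  have "h differentiable (at p)" if "p \<in> U" for p
    by (rule differentiableI[OF has_derivative_transform_within_open[OF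
        Ck_on_Suc_has_derivative[OF Suc.prems(2) that] assms(1) that]])
      (rule Suc.prems(1))
  moreover have "Ck_on k U (\<lambda>p. frechet_derivative h (at p) b)" if "b \<in> Basis" for b
  proof (rule Suc.IH)
    show "frechet_derivative g (at p) b = frechet_derivative h (at p) b" if "p \<in> U" for p
      using frechet_derivative_cong_open[OF assms(1) that, of g h] Suc.prems(1) by simp
    show "Ck_on k U (\<lambda>p. frechet_derivative g (at p) b)"
      using Suc.prems(2) that by simp
  qed
  ultimately show ?case by simp
qed

text \<open>Lets the derivative be supplied as an explicit formula \<open>D\<close>; the closure
  proofs below can then work with the usual differentiation rules instead of
  \<open>frechet_derivative\<close>.\<close>

lemma Ck_on_SucI:
  fixes g :: "'a::euclidean_space \<Rightarrow> real"
  assumes "open U" "\<And>p. p \<in> U \<Longrightarrow> (g has_derivative D p) (at p)"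
    "\<And>b. b \<in> Basis \<Longrightarrow> Ck_on k U (\<lambda>p. D p b)"
  shows "Ck_on (Suc k) U g"
proof -
  have "frechet_derivative g (at p) = D p" if "p \<in> U" for p
    using frechet_derivative_at[OF assms(2)[OF that]] by simp
  then have "Ck_on k U (\<lambda>p. frechet_derivative g (at p) b)" if "b \<in> Basis" for b
    using Ck_on_cong[OF assms(1) _ assms(3)[OF that]] by simp
  then show ?thesis
    using assms(2) by (auto simp: differentiable_def)
qed

lemma Ck_on_SucD:
  fixes g :: "'a::euclidean_space \<Rightarrow> real"
  assumes "Ck_on (Suc k) U g"
  shows "Ck_on k U g"
  using assms
proof (induction k arbitrary: g)
  case 0
  then show ?case
    by (simp add: continuous_at_imp_continuous_on differentiable_imp_continuous_within)
next
  case (Suc k)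
  show ?case
    unfolding Ck_on.simps(2)[of k]
  proof (intro conjI ballI)
    show "g differentiable (at p)" if "p \<in> U" for p
      using Suc.prems that by simp
    show "Ck_on k U (\<lambda>p. frechet_derivative g (at p) b)" if "b \<in> Basis" for b
      \<comment> \<open>Only one level of the recursion is unfolded, so that the partial derivatives
        stay in the form \<open>Ck_on (Suc k)\<close> that the induction hypothesis takes.\<close>
      using Suc.prems that by (intro Suc.IH) (simp del: Ck_on.simps(2) add: Ck_on.simps(2)[of "Suc k"])
  qed
qed

lemma Ck_on_const:
  fixes U :: "'a::euclidean_space set"
  assumes "open U"
  shows "Ck_on k U (\<lambda>p. c)"
proof (induction k arbitrary: c)
  case (Suc k)
  show ?case
    by (rule Ck_on_SucI[OF assms, where D="\<lambda>p h. 0"]) (auto intro: Suc)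
qed simp

text \<open>No induction: the derivative is \<open>L\<close> at every point, so all partial
  derivatives are constants.\<close>

lemma Ck_on_linear:
  fixes U :: "'a::euclidean_space set"
  assumes "open U" "bounded_linear L"
  shows "Ck_on k U L"
proof (cases k)
  case 0
  then show ?thesis
    using assms by (simp add: linear_continuous_on)
next
  case (Suc k)
  show ?thesis
    unfolding Suc
    by (rule Ck_on_SucI[OF assms(1), where D="\<lambda>p. L"])
      (auto intro: Ck_on_const assms bounded_linear_imp_has_derivative)
qed

lemma Ck_on_add:
  fixes g h :: "'a::euclidean_space \<Rightarrow> real"
  assumes "open U" "Ck_on k U g" "Ck_on k U h"
  shows "Ck_on k U (\<lambda>p. g p + h p)"
  using assms(2,3)
proof (induction k arbitrary: g h)
  case 0
  then show ?case by (simp add: continuous_on_add)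
next
  case (Suc k)
  show ?case
    by (rule Ck_on_SucI[OF assms(1)],
        rule has_derivative_add[OF Ck_on_Suc_has_derivative Ck_on_Suc_has_derivative])
      (use Suc in auto)
qed

text \<open>Each term of the product rule pairs a derivative of class \<open>k\<close> with a factor
  of class \<open>Suc k\<close>; the factor is lowered by \<open>Ck_on_SucD\<close> before the
  induction hypothesis applies.\<close>

lemma Ck_on_mult:
  fixes g h :: "'a::euclidean_space \<Rightarrow> real"
  assumes "open U" "Ck_on k U g" "Ck_on k U h"
  shows "Ck_on k U (\<lambda>p. g p * h p)"
  using assms(2,3)
proof (induction k arbitrary: g h)
  case 0
  then show ?case by (simp add: continuous_on_mult)
next
  case (Suc k)
  show ?case
  proof (rule Ck_on_SucI[OF assms(1)])
    show "((\<lambda>p. g p * h p) has_derivative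
        (\<lambda>v. g p * frechet_derivative h (at p) v + frechet_derivative g (at p) v * h p)) (at p)"
      if "p \<in> U" for p
      using Suc.prems that by (intro has_derivative_mult Ck_on_Suc_has_derivative)
    show "Ck_on k U (\<lambda>p. g p * frechet_derivative h (at p) b + frechet_derivative g (at p) b * h p)"
      if "b \<in> Basis" for b
      using Suc.prems that Ck_on_SucD[OF Suc.prems(1)] Ck_on_SucD[OF Suc.prems(2)]
      by (intro Ck_on_add assms(1) Suc.IH) auto
  qed
qed

lemma frechet_derivative_eq_deriv:
  fixes w :: "real \<Rightarrow> real"
  assumes "w differentiable (at x)"
  shows "frechet_derivative w (at x) h = deriv w x * h"
proof -
  have "(w has_real_derivative deriv w x) (at x)"
    using assms by (simp add: DERIV_deriv_iff_real_differentiable)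
  then show ?thesis
    using frechet_derivative_at[of w "(*) (deriv w x)" x] by (simp add: has_field_derivative_def)
qed

lemma Ck_on_real_SucD:
  fixes w :: "real \<Rightarrow> real"
  assumes "open J" "Ck_on (Suc k) J w"
  shows "x \<in> J \<Longrightarrow> (w has_real_derivative deriv w x) (at x)" and "Ck_on k J (deriv w)"
proof -
  show "x \<in> J \<Longrightarrow> (w has_real_derivative deriv w x) (at x)"
    using assms by (simp add: DERIV_deriv_iff_real_differentiable)
  have "Ck_on k J (\<lambda>p. frechet_derivative w (at p) 1)"
    using assms by simp
  then show "Ck_on k J (deriv w)"
    by (rule Ck_on_cong[OF assms(1), rotated]) (use assms in \<open>simp add: frechet_derivative_eq_deriv\<close>)
qed

text \<open>By the chain rule the partial derivatives are \<open>deriv w\<close> at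
  \<open>g p\<close> times those of \<open>g\<close>. The induction therefore varies
  \<open>w\<close> and keeps \<open>g\<close> fixed.\<close>

lemma Ck_on_compose:
  fixes g :: "'a::euclidean_space \<Rightarrow> real" and w :: "real \<Rightarrow> real"
  assumes "open U" "open J" "\<And>p. p \<in> U \<Longrightarrow> g p \<in> J" "Ck_on k J w" "Ck_on k U g"
  shows "Ck_on k U (\<lambda>p. w (g p))"
  using assms(4,5)
proof (induction k arbitrary: w)
  case 0
  then show ?case
    using assms(3) by (auto intro: continuous_on_compose2)
next
  case (Suc k)
  show ?case
  proof (rule Ck_on_SucI[OF assms(1)])
    show "((\<lambda>p. w (g p)) has_derivative (\<lambda>v. deriv w (g p) * frechet_derivative g (at p) v)) (at p)"
      if "p \<in> U" for p
      by (rule has_derivative_compose[OF Ck_on_Suc_has_derivative[OF Suc.prems(2) that]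
            Ck_on_real_SucD(1)[OF assms(2) Suc.prems(1) assms(3)[OF that],
              unfolded has_field_derivative_def]])
    show "Ck_on k U (\<lambda>p. deriv w (g p) * frechet_derivative g (at p) b)" if "b \<in> Basis" for b
    proof (rule Ck_on_mult[OF assms(1)])
      show "Ck_on k U (\<lambda>p. deriv w (g p))"
        by (rule Suc.IH[OF Ck_on_real_SucD(2)[OF assms(2) Suc.prems(1)] Ck_on_SucD[OF Suc.prems(2)]])
      show "Ck_on k U (\<lambda>p. frechet_derivative g (at p) b)"
        using that Suc.prems(2) by simp
    qed
  qed
qed

text \<open>The derivative of \<open>1/g\<close> is a product of two copies of \<open>1/g\<close>
  and a derivative of \<open>g\<close>, so the induction hypothesis is applied to the same
  \<open>g\<close>.\<close>

lemma Ck_on_inverse: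
  fixes g :: "'a::euclidean_space \<Rightarrow> real"
  assumes "open U" "\<And>p. p \<in> U \<Longrightarrow> g p \<noteq> 0" "Ck_on k U g"
  shows "Ck_on k U (\<lambda>p. inverse (g p))"
  using assms(3)
proof (induction k)
  case 0
  then show ?case
    using assms(2) by (auto intro: continuous_on_inverse)
next
  case (Suc k)
  note IH = Suc.IH[OF Ck_on_SucD[OF Suc.prems]]
  show ?case
  proof (rule Ck_on_SucI[OF assms(1)])
    show "((\<lambda>p. inverse (g p)) has_derivative
        (\<lambda>v. - (inverse (g p) * frechet_derivative g (at p) v * inverse (g p)))) (at p)"
      if "p \<in> U" for p
      using assms(2)[OF that] Ck_on_Suc_has_derivative[OF Suc.prems that]
      by (auto intro!: derivative_eq_intros)
    show "Ck_on k U (\<lambda>p. - (inverse (g p) * frechet_derivative g (at p) b * inverse (g p)))"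
      if "b \<in> Basis" for b
    proof -
      have "Ck_on k U (\<lambda>p. (-1) * (inverse (g p) * frechet_derivative g (at p) b * inverse (g p)))"
        using IH Suc.prems that by (intro Ck_on_mult Ck_on_const assms(1)) auto
      then show ?thesis by simp
    qed
  qed
qed

lemma Ck_on_minus:
  fixes g :: "'a::euclidean_space \<Rightarrow> real"
  assumes "open U" "Ck_on k U g"
  shows "Ck_on k U (\<lambda>p. - g p)"
  using Ck_on_mult[OF assms(1) Ck_on_const[OF assms(1), of k "-1"] assms(2)] by simp

lemma Ck_on_diff:
  fixes g h :: "'a::euclidean_space \<Rightarrow> real"
  assumes "open U" "Ck_on k U g" "Ck_on k U h"
  shows "Ck_on k U (\<lambda>p. g p - h p)"
  using Ck_on_add[OF assms(1,2) Ck_on_minus[OF assms(1,3)]] by simp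

lemma Ck_on_divide:
  fixes g h :: "'a::euclidean_space \<Rightarrow> real"
  assumes "open U" "\<And>p. p \<in> U \<Longrightarrow> h p \<noteq> 0" "Ck_on k U g" "Ck_on k U h"
  shows "Ck_on k U (\<lambda>p. g p / h p)"
  using Ck_on_mult[OF assms(1,3) Ck_on_inverse[OF assms(1,2,4)]] by (simp add: divide_inverse)

lemma Ck_on_power:
  fixes g :: "'a::euclidean_space \<Rightarrow> real"
  assumes "open U" "Ck_on k U g"
  shows "Ck_on k U (\<lambda>p. g p ^ n)"
  by (induction n) (auto intro: Ck_on_const Ck_on_mult assms)

lemma Ck_on_fst_snd:
  fixes U :: "base set"
  assumes "open U"
  shows "Ck_on k U fst" "Ck_on k U (\<lambda>p. fst (snd p))" "Ck_on k U (\<lambda>p. snd (snd p))"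
  using assms
  by (auto intro!: Ck_on_linear bounded_linear_compose[of fst snd] bounded_linear_compose[of snd snd]
      bounded_linear_fst bounded_linear_snd)

lemmas Ck_on_intros = Ck_on_add Ck_on_mult Ck_on_diff Ck_on_divide Ck_on_power Ck_on_const
  Ck_on_fst_snd

lemma smooth_on_deriv:
  fixes w :: "real \<Rightarrow> real"
  assumes "open J" "smooth_on J w"
  shows "smooth_on J (deriv w)" "x \<in> J \<Longrightarrow> (w has_real_derivative deriv w x) (at x)"
  using assms Ck_on_real_SucD[of J _ w] unfolding smooth_on_def by blast+

subsection \<open>Partial derivatives and tangency\<close>

text \<open>Chain rule for \<open>u\<close> along the three coordinate lines through the point.
  Linearity of \<open>D\<close> turns its value on a multiple of a basis vector into the
  multiplication that \<open>has_field_derivative\<close> expects.\<close>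

lemma deriv_along_basis:
  fixes u :: "base \<Rightarrow> real"
  assumes "(u has_derivative D) (at (t, x, y))"
  shows "((\<lambda>s. u (s, x, y)) has_real_derivative D (1, 0, 0)) (at t)"
    "((\<lambda>s. u (t, s, y)) has_real_derivative D (0, 1, 0)) (at x)"
    "((\<lambda>s. u (t, x, s)) has_real_derivative D (0, 0, 1)) (at y)"
proof -
  have lin: "D (c *\<^sub>R v) = c * D v" for c v
    using linear_scale[OF has_derivative_linear[OF assms]] by simp
  have D1: "(*) (D (1, 0, 0)) = (\<lambda>h. D (h, 0, 0))"
  proof
    show "D (1, 0, 0) * h = D (h, 0, 0)" for h
      using lin[of h "(1, 0, 0)"] by simp
  qed
  show "((\<lambda>s. u (s, x, y)) has_real_derivative D (1, 0, 0)) (at t)"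
    unfolding has_field_derivative_def D1
    by (rule has_derivative_compose[of "\<lambda>s. (s, x, y)", OF _ assms])
      (auto intro!: derivative_eq_intros simp: zero_prod_def)
  have D2: "(*) (D (0, 1, 0)) = (\<lambda>h. D (0, h, 0))"
  proof
    show "D (0, 1, 0) * h = D (0, h, 0)" for h
      using lin[of h "(0, 1, 0)"] by simp
  qed
  show "((\<lambda>s. u (t, s, y)) has_real_derivative D (0, 1, 0)) (at x)"
    unfolding has_field_derivative_def D2
    by (rule has_derivative_compose[of "\<lambda>s. (t, s, y)", OF _ assms])
      (auto intro!: derivative_eq_intros simp: zero_prod_def)
  have D3: "(*) (D (0, 0, 1)) = (\<lambda>h. D (0, 0, h))"
  proof
    show "D (0, 0, 1) * h = D (0, 0, h)" for h
      using lin[of h "(0, 0, 1)"] by simp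
  qed
  show "((\<lambda>s. u (t, x, s)) has_real_derivative D (0, 0, 1)) (at y)"
    unfolding has_field_derivative_def D3
    by (rule has_derivative_compose[of "\<lambda>s. (t, x, s)", OF _ assms])
      (auto intro!: derivative_eq_intros simp: zero_prod_def)
qed

lemma has_derivative_partials:
  fixes u :: "base \<Rightarrow> real"
  assumes "(u has_derivative D) (at p)"
  shows "D (a, b, c) = a * D_t u p + b * D_x u p + c * D_y u p"
proof -
  obtain t x y where p: "p = (t, x, y)" by (cases p) auto
  have lin: "linear D" by (rule has_derivative_linear[OF assms])
  have "(a, b, c) = a *\<^sub>R (1, 0, 0) + b *\<^sub>R (0, 1, 0) + c *\<^sub>R (0, 0, 1 :: real)"
    by simp
  then have "D (a, b, c) = a * D (1, 0, 0) + b * D (0, 1, 0) + c * D (0, 0, 1)"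
    by (simp only: linear_add[OF lin] linear_scale[OF lin] real_scaleR_def)
  moreover have "D_t u p = D (1, 0, 0)" "D_x u p = D (0, 1, 0)" "D_y u p = D (0, 0, 1)"
    unfolding p D_t_def D_x_def D_y_def prod.case
    by (rule DERIV_imp_deriv deriv_along_basis[OF assms[unfolded p]])+
  ultimately show ?thesis by simp
qed

text \<open>The parametrisation of the graph has derivative \<open>h\<close> to
  \<open>(h, D h)\<close>. A vector is thus tangent when its last component is \<open>D\<close> of
  the first three, and \<open>D\<close> is expressed by partial derivatives. The preimage of the
  field vector is \<open>(a, b, c)\<close>.\<close>

lemma invariant_underI:
  assumes "Ck_on (Suc k) U u"
    and "\<And>t x y. (t, x, y) \<in> U \<Longrightarrow> \<exists>a b c. V (t, x, y, u (t, x, y)) =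
      (a, b, c, a * D_t u (t, x, y) + b * D_x u (t, x, y) + c * D_y u (t, x, y))"
  shows "invariant_under V U u"
  unfolding invariant_under_def
proof
  fix p assume p: "p \<in> U"
  define D where "D = frechet_derivative u (at p)"
  have D: "(u has_derivative D) (at p)"
    unfolding D_def using Ck_on_Suc_has_derivative[OF assms(1) p] .
  have gm: "graph_map u = (\<lambda>p. (fst p, fst (snd p), snd (snd p), u p))"
    by (auto simp: graph_map_def fun_eq_iff)
  have "(graph_map u has_derivative (\<lambda>h. (fst h, fst (snd h), snd (snd h), D h))) (at p)"
    unfolding gm by (auto intro!: derivative_eq_intros D)
  moreover obtain a b c where "V (graph_map u p) = (a, b, c, D (a, b, c))"
    using assms(2) p has_derivative_partials[OF D]
    by (cases p) (fastforce simp: graph_map_def)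
  ultimately show "\<exists>G'. (graph_map u has_derivative G') (at p) \<and> V (graph_map u p) \<in> range G'"
    by (intro exI[of _ "\<lambda>h. (fst h, fst (snd h), snd (snd h), D h)"])
      (auto intro!: image_eqI[of _ _ "(a, b, c)"])
qed

text \<open>Allows a second partial derivative to be computed from a formula for the first that is
  known only on \<open>U\<close>. The preimage of \<open>U\<close> under a coordinate line is an
  open neighbourhood of the parameter.\<close>

lemma partials_cong_open:
  fixes u v :: "base \<Rightarrow> real"
  assumes "open U" "(t, x, y) \<in> U" "\<forall>q\<in>U. u q = v q"
  shows "D_t u (t, x, y) = D_t v (t, x, y)" "D_x u (t, x, y) = D_x v (t, x, y)"
    "D_y u (t, x, y) = D_y v (t, x, y)"
proof -
  have *: "\<forall>\<^sub>F s in nhds r. u (h s) = v (h s)"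
    if "continuous_on UNIV h" "h r = (t, x, y)" for h and r :: real
    unfolding eventually_nhds
    by (rule exI[of _ "h -` U"]) (use that assms in \<open>auto intro: open_vimage\<close>)
  show "D_t u (t, x, y) = D_t v (t, x, y)"
    unfolding D_t_def prod.case
    by (rule deriv_cong_ev[OF *[of "\<lambda>s. (s, x, y)" t] refl]) (auto intro!: continuous_intros)
  show "D_x u (t, x, y) = D_x v (t, x, y)"
    unfolding D_x_def prod.case
    by (rule deriv_cong_ev[OF *[of "\<lambda>s. (t, s, y)" x] refl]) (auto intro!: continuous_intros)
  show "D_y u (t, x, y) = D_y v (t, x, y)"
    unfolding D_y_def prod.case
    by (rule deriv_cong_ev[OF *[of "\<lambda>s. (t, x, s)" y] refl]) (auto intro!: continuous_intros)
qed

subsection \<open>The reduction ansatz\<close>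

text \<open>Stated for a general \<open>U\<close> because it is used twice: first to show that
  \<open>u_dom\<close> is open, then on \<open>u_dom\<close> itself.\<close>

lemma Ck_on_z_var:
  assumes "open I" "smooth_on I f" "open U" "\<And>t x y. (t, x, y) \<in> U \<Longrightarrow> t \<in> I \<and> y \<noteq> 0"
  shows "Ck_on k U (z_var f)"
proof -
  have U: "fst p \<in> I" "snd (snd p) \<noteq> 0" if "p \<in> U" for p
    using assms(4)[of "fst p" "fst (snd p)" "snd (snd p)"] that by auto
  have f: "Ck_on k U (\<lambda>p. f (fst p))" "Ck_on k U (\<lambda>p. deriv f (fst p))"
    using assms(2) smooth_on_deriv(1)[OF assms(1,2)] U(1)
    by (simp_all add: Ck_on_compose[OF assms(3,1) _ _ Ck_on_fst_snd(1)[OF assms(3)]] smooth_on_def)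
  show ?thesis
    unfolding z_var_def case_prod_beta
    by (intro Ck_on_intros assms(3) f) (use U in auto)
qed

lemma open_u_dom:
  assumes "open I" "open J" "smooth_on I f"
  shows "open (u_dom f I J)"
proof -
  \<comment> \<open>\<open>V\<close> is \<open>u_dom\<close> without the condition on
    \<open>z\<close>; that condition is then the preimage of \<open>J\<close> under a continuous
    function.\<close>
  define V :: "base set" where "V = I \<times> UNIV \<times> (- {0})"
  have V: "open V"
    unfolding V_def using assms by (intro open_Times) auto
  have "Ck_on 0 V (z_var f)"
    by (rule Ck_on_z_var[OF assms(1,3) V]) (auto simp: V_def)
  then have "open (V \<inter> z_var f -` J)"
    using V assms(2) by (auto intro: continuous_open_preimage)
  also have "V \<inter> z_var f -` J = u_dom f I J"
    by (auto simp: V_def u_dom_def)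
  finally show ?thesis .
qed

lemma Ck_on_u_of:
  assumes "open I" "open J" "smooth_on I f" "smooth_on J w" "\<forall>t\<in>I. f t \<noteq> 0"
  shows "Ck_on k (u_dom f I J) (u_of f w)"
proof -
  note o = open_u_dom[OF assms(1-3)]
  let ?U = "u_dom f I J"
  have U: "fst p \<in> I" "snd (snd p) \<noteq> 0" "z_var f p \<in> J" if "p \<in> ?U" for p
    using that by (auto simp: u_dom_def)
  have s: "smooth_on I (deriv f)" "smooth_on I ((deriv ^^ 2) f)"
    using smooth_on_deriv(1)[OF assms(1)] assms(3) by (auto simp: numeral_2_eq_2)
  have f: "Ck_on k ?U (\<lambda>p. f (fst p))" "Ck_on k ?U (\<lambda>p. deriv f (fst p))"
    "Ck_on k ?U (\<lambda>p. (deriv ^^ 2) f (fst p))"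
    using assms(3) s U(1)
    by (simp_all add: Ck_on_compose[OF o assms(1) _ _ Ck_on_fst_snd(1)[OF o]] smooth_on_def)
  have z: "Ck_on k ?U (z_var f)"
    by (rule Ck_on_z_var[OF assms(1,3) o]) (auto simp: u_dom_def)
  have w: "Ck_on k ?U (\<lambda>p. w (z_var f p))"
    by (rule Ck_on_compose[OF o assms(2) U(3) _ z]) (use assms(4) in \<open>auto simp: smooth_on_def\<close>)
  show ?thesis
    unfolding u_of_def case_prod_beta prod.collapse
    by (intro Ck_on_intros o f w) (use U assms(5) in auto)
qed


lemma z_var_derivatives:
  assumes "open I" "smooth_on I f" "t \<in> I" "y \<noteq> 0"
  shows "((\<lambda>s. z_var f (s, x, y)) has_real_derivative
      deriv f t * x / y^2 - (deriv ^^ 2) f t / 6) (at t)"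
    and "((\<lambda>s. z_var f (t, s, y)) has_real_derivative f t / y^2) (at x)"
    and "((\<lambda>s. z_var f (t, x, s)) has_real_derivative - 2 * f t * x / y^3) (at y)"
proof -
  note f = smooth_on_deriv(2)[OF assms(1,2,3)]
    smooth_on_deriv(2)[OF assms(1) smooth_on_deriv(1)[OF assms(1,2)] assms(3)]
  show "((\<lambda>s. z_var f (s, x, y)) has_real_derivative
      deriv f t * x / y^2 - (deriv ^^ 2) f t / 6) (at t)"
    unfolding z_var_def using assms(4)
    by (auto intro!: derivative_eq_intros f simp: numeral_2_eq_2)
  show "((\<lambda>s. z_var f (t, s, y)) has_real_derivative f t / y^2) (at x)"
    unfolding z_var_def using assms(4)
    by (auto intro!: derivative_eq_intros simp: field_simps eval_nat_numeral)
  show "((\<lambda>s. z_var f (t, x, s)) has_real_derivative - 2 * f t * x / y^3) (at y)"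
    unfolding z_var_def using assms(4)
    by (auto intro!: derivative_eq_intros simp: field_simps power2_eq_square power3_eq_cube)
qed

section \<open>First and second partial derivatives of the ansatz at a point\<close>

context
  fixes f w :: "real \<Rightarrow> real" and I J :: "real set" and t x y :: real
  assumes I: "open I" and J: "open J" and f: "smooth_on I f" and w: "smooth_on J w"
    and f_nz: "\<forall>t\<in>I. f t \<noteq> 0" and p: "(t, x, y) \<in> u_dom f I J"
begin

private lemma t: "t \<in> I" and y: "y \<noteq> 0" and z: "z_var f (t, x, y) \<in> J"
  using p by (auto simp: u_dom_def)

private lemma f_nz': "f t \<noteq> 0"
  using f_nz t by blast

private lemma f_derivs:
  "(f has_real_derivative deriv f t) (at t)"
  "(deriv f has_real_derivative (deriv ^^ 2) f t) (at t)"
  "((deriv ^^ 2) f has_real_derivative (deriv ^^ 3) f t) (at t)"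
  using smooth_on_deriv[OF I] f t by (auto simp: numeral_2_eq_2 numeral_3_eq_3)

private lemma w_derivs:
  "(w has_real_derivative deriv w (z_var f (t, x, y))) (at (z_var f (t, x, y)))"
  "(deriv w has_real_derivative (deriv ^^ 2) w (z_var f (t, x, y))) (at (z_var f (t, x, y)))"
  using smooth_on_deriv[OF J] w z by (auto simp: numeral_2_eq_2)

private lemmas z_derivs = z_var_derivatives[OF I f t y]

text \<open>Three rules differentiate \<open>w\<close> along the coordinate lines, three
  differentiate \<open>deriv w\<close>; the latter serve the second derivatives of the
  ansatz.\<close>

private lemmas wz_derivs =
  DERIV_chain2[where g = "\<lambda>s. z_var f (s, x, y)", OF w_derivs(1) z_derivs(1)]
  DERIV_chain2[where g = "\<lambda>s. z_var f (t, s, y)", OF w_derivs(1) z_derivs(2)]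
  DERIV_chain2[where g = "\<lambda>s. z_var f (t, x, s)", OF w_derivs(1) z_derivs(3)]
  DERIV_chain2[where g = "\<lambda>s. z_var f (s, x, y)", OF w_derivs(2) z_derivs(1)]
  DERIV_chain2[where g = "\<lambda>s. z_var f (t, s, y)", OF w_derivs(2) z_derivs(2)]
  DERIV_chain2[where g = "\<lambda>s. z_var f (t, x, s)", OF w_derivs(2) z_derivs(3)]

lemma DERIV_u_of_t:
  "((\<lambda>s. u_of f w (s, x, y)) has_real_derivative
     y^2 * deriv w (z_var f (t, x, y)) / (6 * (f t)^2)
       * (deriv f t * x / y^2 - (deriv ^^ 2) f t / 6)
     - y^2 * deriv f t * w (z_var f (t, x, y)) / (3 * (f t)^3)
     + 2 * y^2 * deriv f t * (deriv ^^ 2) f t / (9 * (f t)^2)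
     - 2 * y^2 * (deriv f t)^3 / (9 * (f t)^3)
     - x * (deriv ^^ 2) f t / (3 * f t) + x * (deriv f t)^2 / (3 * (f t)^2)
     - y^2 * (deriv ^^ 3) f t / (6 * f t)
     + y^2 * (deriv ^^ 2) f t * deriv f t / (6 * (f t)^2)) (at t)"
  \<comment> \<open>As \<open>f t\<close> and \<open>y\<close> are nonzero, denominators can be
    cleared, and comparing the computed derivative with the stated one becomes a polynomial
    identity.\<close>
  unfolding u_of_def prod.case using f_nz' y
  by (auto intro!: derivative_eq_intros f_derivs wz_derivs, simp add: divide_simps, algebra)

text \<open>The prefactor \<open>y^2 / (6 f^2)\<close> cancels against \<open>z_x = f / y^2\<close>,
  so \<open>u_x\<close> depends on \<open>t\<close> and \<open>z\<close> alone.\<close>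

lemma DERIV_u_of_x:
  "((\<lambda>s. u_of f w (t, s, y)) has_real_derivative
     deriv w (z_var f (t, x, y)) / (6 * f t) - deriv f t / (3 * f t)) (at x)"
  unfolding u_of_def prod.case using f_nz' y
  by (auto intro!: derivative_eq_intros wz_derivs, simp add: divide_simps, algebra)

lemma DERIV_u_of_y:
  "((\<lambda>s. u_of f w (t, x, s)) has_real_derivative
     y * w (z_var f (t, x, y)) / (3 * (f t)^2) - x * deriv w (z_var f (t, x, y)) / (3 * f t * y)
     + 2 * y * (deriv f t)^2 / (9 * (f t)^2) - y * (deriv ^^ 2) f t / (3 * f t)) (at y)"
  unfolding u_of_def prod.case using f_nz' y
  by (auto intro!: derivative_eq_intros wz_derivs, simp add: divide_simps, algebra)

text \<open>Differentiates the closed formula for \<open>u_x\<close> just found; that this gives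
  \<open>D_t (D_x u)\<close> follows later from agreement on the open domain.\<close>

lemma DERIV_u_of_x_t:
  "((\<lambda>s. deriv w (z_var f (s, x, y)) / (6 * f s) - deriv f s / (3 * f s)) has_real_derivative
     (deriv ^^ 2) w (z_var f (t, x, y)) * (deriv f t * x / y^2 - (deriv ^^ 2) f t / 6) / (6 * f t)
     - deriv w (z_var f (t, x, y)) * deriv f t / (6 * (f t)^2)
     - (deriv ^^ 2) f t / (3 * f t) + (deriv f t)^2 / (3 * (f t)^2)) (at t)"
  using f_nz' y
  by (auto intro!: derivative_eq_intros f_derivs wz_derivs, simp add: divide_simps, algebra)

lemma DERIV_u_of_x_x:
  "((\<lambda>s. deriv w (z_var f (t, s, y)) / (6 * f t) - deriv f t / (3 * f t)) has_real_derivative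
     (deriv ^^ 2) w (z_var f (t, x, y)) / (6 * y^2)) (at x)"
  using f_nz' y
  by (auto intro!: derivative_eq_intros wz_derivs)

lemma DERIV_u_of_y_y:
  "((\<lambda>s. s * w (z_var f (t, x, s)) / (3 * (f t)^2) - x * deriv w (z_var f (t, x, s)) / (3 * f t * s)
     + 2 * s * (deriv f t)^2 / (9 * (f t)^2) - s * (deriv ^^ 2) f t / (3 * f t)) has_real_derivative
     w (z_var f (t, x, y)) / (3 * (f t)^2) - x * deriv w (z_var f (t, x, y)) / (3 * f t * y^2)
     + 2 * x^2 * (deriv ^^ 2) w (z_var f (t, x, y)) / (3 * y^4)
     + 2 * (deriv f t)^2 / (9 * (f t)^2) - (deriv ^^ 2) f t / (3 * f t)) (at y)"
  using f_nz' y
  by (auto intro!: derivative_eq_intros wz_derivs, simp add: divide_simps, algebra)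

end

section \<open>The ZK residual of the ansatz\<close>

lemma ZK_residual_u_of:
  assumes I: "open I" and J: "open J" and f: "smooth_on I f" and w: "smooth_on J w"
    and f_nz: "\<forall>t\<in>I. f t \<noteq> 0" and p: "(t, x, y) \<in> u_dom f I J"
  defines "z \<equiv> z_var f (t, x, y)" and "u \<equiv> u_of f w"
  shows "D_t (D_x u) (t, x, y) - D_x (\<lambda>q. u q * D_x u q) (t, x, y) - D_y (D_y u) (t, x, y) =
    - (12 * w z - 12 * z * deriv w z + (deriv w z)^2 + (w z + 24 * z^2) * (deriv ^^ 2) w z)
      / (36 * (f t)^2)"
proof -
  let ?U = "u_dom f I J"
  define ux where "ux = (\<lambda>(t, x, y). deriv w (z_var f (t, x, y)) / (6 * f t) - deriv f t / (3 * f t))"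
  define uy where "uy = (\<lambda>(t, x, y).
     y * w (z_var f (t, x, y)) / (3 * (f t)^2) - x * deriv w (z_var f (t, x, y)) / (3 * f t * y)
     + 2 * y * (deriv f t)^2 / (9 * (f t)^2) - y * (deriv ^^ 2) f t / (3 * f t))"
  have ux: "\<forall>q\<in>?U. D_x u q = ux q"
    using DERIV_u_of_x[OF I J f w f_nz, THEN DERIV_imp_deriv]
    by (auto simp: D_x_def ux_def u_def)
  have uy: "\<forall>q\<in>?U. D_y u q = uy q"
    using DERIV_u_of_y[OF I J f w f_nz, THEN DERIV_imp_deriv]
    by (auto simp: D_y_def uy_def u_def)
  note cong = partials_cong_open[OF open_u_dom[OF I J f] p]
  have f0: "f t \<noteq> 0" and y0: "y \<noteq> 0"
    using p f_nz by (auto simp: u_dom_def)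
  have xt: "D_t (D_x u) (t, x, y) =
     (deriv ^^ 2) w z * (deriv f t * x / y^2 - (deriv ^^ 2) f t / 6) / (6 * f t)
     - deriv w z * deriv f t / (6 * (f t)^2)
     - (deriv ^^ 2) f t / (3 * f t) + (deriv f t)^2 / (3 * (f t)^2)"
    unfolding cong(1)[OF ux]
    unfolding D_t_def ux_def prod.case z_def
    by (rule DERIV_imp_deriv[OF DERIV_u_of_x_t[OF I J f w f_nz p]])
  have "D_x (\<lambda>q. u q * D_x u q) (t, x, y) = D_x (\<lambda>q. u q * ux q) (t, x, y)"
    by (rule cong(2)) (simp add: ux)
  \<comment> \<open>Product rule for \<open>u * u_x\<close>, where
    \<open>u_xx = w'' / (6 y^2)\<close>.\<close>
  also have "\<dots> = ux (t, x, y) * ux (t, x, y) + (deriv ^^ 2) w z / (6 * y^2) * u (t, x, y)"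
    unfolding D_x_def ux_def prod.case z_def u_def
    by (rule DERIV_imp_deriv[OF DERIV_mult[OF DERIV_u_of_x[OF I J f w f_nz p]
            DERIV_u_of_x_x[OF I J f w f_nz p]]])
  finally have xx: "D_x (\<lambda>q. u q * D_x u q) (t, x, y) =
    ux (t, x, y) * ux (t, x, y) + (deriv ^^ 2) w z / (6 * y^2) * u (t, x, y)" .
  have yy: "D_y (D_y u) (t, x, y) =
     w z / (3 * (f t)^2) - x * deriv w z / (3 * f t * y^2)
     + 2 * x^2 * (deriv ^^ 2) w z / (3 * y^4)
     + 2 * (deriv f t)^2 / (9 * (f t)^2) - (deriv ^^ 2) f t / (3 * f t)"
    unfolding cong(3)[OF uy]
    unfolding D_y_def uy_def prod.case z_def
    by (rule DERIV_imp_deriv[OF DERIV_u_of_y_y[OF I J f w f_nz p]])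
  \<comment> \<open>The definition of \<open>z\<close> solved for \<open>x\<close>.\<close>
  have x: "x = (z + deriv f t / 6) * y^2 / f t"
    using f0 y0 by (simp add: z_def z_var_def)
  show ?thesis
    unfolding xt xx yy
    \<comment> \<open>The arguments of \<open>w\<close> are folded to \<open>z\<close> before
      \<open>x\<close> is eliminated, since the substitution would otherwise act inside them. What
      remains is a rational identity in which \<open>z\<close>, \<open>w z\<close> and its
      derivatives are independent quantities.\<close>
    unfolding u_def ux_def u_of_def prod.case z_def[symmetric]
    unfolding x using f0 y0
    by (simp add: divide_simps, algebra)
qed

section \<open>Invariance under the two fields\<close>

text \<open>\<open>v0\<close> generates the scaling of \<open>x\<close>, \<open>y\<close>,
  \<open>u\<close> with weights 2, 1, 2, which fixes \<open>t\<close> and \<open>z\<close>. Tangency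
  is Euler's relation \<open>2 u = 2 x u_x + y u_y\<close>.\<close>

lemma invariant_v0_u_of:
  assumes "open I" "open J" "smooth_on I f" "smooth_on J w" "\<forall>t\<in>I. f t \<noteq> 0"
  shows "invariant_under v0 (u_dom f I J) (u_of f w)"
proof (rule invariant_underI[OF Ck_on_u_of[OF assms, where k = "Suc 0"]])
  fix t x y assume p: "(t, x, y) \<in> u_dom f I J"
  note D = DERIV_u_of_x[OF assms p, THEN DERIV_imp_deriv] DERIV_u_of_y[OF assms p, THEN DERIV_imp_deriv]
  have nz: "f t \<noteq> 0" "y \<noteq> 0"
    using p assms(5) by (auto simp: u_dom_def)
  have "2 * u_of f w (t, x, y) = 2 * x * D_x (u_of f w) (t, x, y) + y * D_y (u_of f w) (t, x, y)"
    unfolding D_x_def D_y_def prod.case D unfolding u_of_def prod.case using nz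
    by (simp add: divide_simps, algebra)
  then show "\<exists>a b c. v0 (t, x, y, u_of f w (t, x, y)) = (a, b, c, a * D_t (u_of f w) (t, x, y)
      + b * D_x (u_of f w) (t, x, y) + c * D_y (u_of f w) (t, x, y))"
    by (simp add: v0_def)
qed

text \<open>The field annihilates \<open>z\<close>, so the terms with \<open>w'\<close> cancel. The
  third derivative of \<open>f\<close> enters through \<open>u_t\<close> and through the last
  component of the field, with equal contributions.\<close>

lemma invariant_z_field_u_of:
  assumes "open I" "open J" "smooth_on I f" "smooth_on J w" "\<forall>t\<in>I. f t \<noteq> 0"
  shows "invariant_under (z_field f) (u_dom f I J) (u_of f w)"
proof (rule invariant_underI[OF Ck_on_u_of[OF assms, where k = "Suc 0"]])
  fix t x y assume p: "(t, x, y) \<in> u_dom f I J"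
  let ?u = "u_of f w"
  note D = DERIV_u_of_t[OF assms p, THEN DERIV_imp_deriv]
    DERIV_u_of_x[OF assms p, THEN DERIV_imp_deriv] DERIV_u_of_y[OF assms p, THEN DERIV_imp_deriv]
  have nz: "f t \<noteq> 0" "y \<noteq> 0"
    using p assms(5) by (auto simp: u_dom_def)
  have "1/6 * (- 4 * ?u (t, x, y) * deriv f t - 2 * x * (deriv ^^ 2) f t - y^2 * (deriv ^^ 3) f t) =
    f t * D_t ?u (t, x, y) + 1/6 * (2 * x * deriv f t + y^2 * (deriv ^^ 2) f t) * D_x ?u (t, x, y)
      + 2 * y / 3 * deriv f t * D_y ?u (t, x, y)"
    unfolding D_t_def D_x_def D_y_def prod.case D unfolding u_of_def prod.case using nz
    by (simp add: divide_simps, algebra)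
  then show "\<exists>a b c. z_field f (t, x, y, ?u (t, x, y)) =
      (a, b, c, a * D_t ?u (t, x, y) + b * D_x ?u (t, x, y) + c * D_y ?u (t, x, y))"
    unfolding z_field_def prod.case by blast
qed

section \<open>Equivalence with the reduced equation\<close>

lemma solves_ZK_u_of_iff:
  assumes "open I" "I \<noteq> {}" "open J" "smooth_on I f" "smooth_on J w" "\<forall>t\<in>I. f t \<noteq> 0"
  shows "solves_ZK (u_dom f I J) (u_of f w) \<longleftrightarrow> solves_reduced_ODE J w"
proof -
  define R where "R z = 12 * w z - 12 * z * deriv w z + (deriv w z)^2
    + (w z + 24 * z^2) * (deriv ^^ 2) w z" for z
  have "solves_ZK (u_dom f I J) (u_of f w) \<longleftrightarrow>
      (\<forall>p\<in>u_dom f I J. R (z_var f p) = 0)"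
    \<comment> \<open>The regularity clause of \<open>solves_ZK\<close> always holds for the ansatz,
      and the residual is \<open>R\<close> times the nonzero factor
      \<open>-1 / (36 f^2)\<close>.\<close>
    using Ck_on_u_of[OF assms(1,3-6), where k = 2] ZK_residual_u_of[OF assms(1,3-6)] assms(6)
    by (auto simp: solves_ZK_def R_def[symmetric] u_dom_def)
  also have "\<dots> \<longleftrightarrow> (\<forall>z\<in>J. R z = 0)"
  proof (intro iffI ballI)
    fix z assume *: "\<forall>p\<in>u_dom f I J. R (z_var f p) = 0" and z: "z \<in> J"
    obtain t where t: "t \<in> I"
      using assms(2) by blast
    \<comment> \<open>The second coordinate solves \<open>z_var = z\<close> for \<open>x\<close> at
      \<open>y = 1\<close>.\<close>
    then have zv: "z_var f (t, (z + deriv f t / 6) / f t, 1) = z"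
      using assms(6) by (simp add: z_var_def)
    then have "(t, (z + deriv f t / 6) / f t, 1) \<in> u_dom f I J"
      using t z by (simp add: u_dom_def)
    then show "R z = 0"
      using *[rule_format, of "(t, (z + deriv f t / 6) / f t, 1)"] zv by simp
  qed (auto simp: u_dom_def)
  finally show ?thesis
    by (simp add: solves_reduced_ODE_def R_def)
qed

theorem mainTheorem7:
  fixes f :: "real \<Rightarrow> real" and I :: "real set"
  assumes "open I" and "is_interval I" and "I \<noteq> {}"
    and "smooth_on I f"
    and "\<And>t. t \<in> I \<Longrightarrow> f t \<noteq> 0"
  shows "(\<forall>(J :: real set) (w :: real \<Rightarrow> real).
            open J \<and> is_interval J \<and> smooth_on J w \<longrightarrow>
              invariant_under v0 (u_dom f I J) (u_of f w) \<and>
              invariant_under (z_field f) (u_dom f I J) (u_of f w) \<and>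
              (solves_ZK (u_dom f I J) (u_of f w) \<longleftrightarrow> solves_reduced_ODE J w))
       \<and> solves_ZK {(t, x, y). t \<in> I \<and> y \<noteq> 0}
           (\<lambda>(t, x, y). y^2 / (6 * (f t)^2) *
              (2/3 * (deriv f t)^2 - (2 * x / y^2 * deriv f t + (deriv ^^ 2) f t) * f t))"
proof -
  have f_nz: "\<forall>t\<in>I. f t \<noteq> 0"
    using assms(5) by blast
  show ?thesis
  proof (intro conjI allI impI)
    fix J :: "real set" and w :: "real \<Rightarrow> real"
    assume "open J \<and> is_interval J \<and> smooth_on J w"
    then have J: "open J" "smooth_on J w" by auto
    note a = assms(1) J(1) assms(4) J(2) f_nz
    show "invariant_under v0 (u_dom f I J) (u_of f w)"
      by (rule invariant_v0_u_of[OF a])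
    show "invariant_under (z_field f) (u_dom f I J) (u_of f w)"
      by (rule invariant_z_field_u_of[OF a])
    show "solves_ZK (u_dom f I J) (u_of f w) \<longleftrightarrow> solves_reduced_ODE J w"
      by (rule solves_ZK_u_of_iff[OF assms(1,3) J(1) assms(4) J(2) f_nz])
  next
    let ?w = "\<lambda>z :: real. 0 :: real"
    \<comment> \<open>The zero function is a fixed point of \<open>deriv\<close>, so its second
      derivative in the reduced equation vanishes too.\<close>
    have "deriv ?w = ?w" by (simp add: fun_eq_iff)
    then have "solves_reduced_ODE UNIV ?w"
      by (simp add: solves_reduced_ODE_def numeral_2_eq_2)
    moreover have "smooth_on UNIV ?w"
      by (simp add: smooth_on_def Ck_on_const)
    \<comment> \<open>With \<open>J = UNIV\<close> the condition on \<open>z\<close> in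
      \<open>u_dom\<close> is void, which leaves the domain of the explicit solution.\<close>
    ultimately have "solves_ZK (u_dom f I UNIV) (u_of f ?w)"
      using solves_ZK_u_of_iff[OF assms(1,3) open_UNIV assms(4) _ f_nz] by blast
    then show "solves_ZK {(t, x, y). t \<in> I \<and> y \<noteq> 0}
        (\<lambda>(t, x, y). y^2 / (6 * (f t)^2) *
          (2/3 * (deriv f t)^2 - (2 * x / y^2 * deriv f t + (deriv ^^ 2) f t) * f t))"
      by (simp add: u_dom_def u_of_def)
  qed
qed

end
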